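(* Let $m \geq 1$ be an integer. Then \[ I(C_{m,5}) \simeq \begin{cases} S^{m-1} & \text{if } m \text{ is even},\\ S^{m} & \text{if } m \text{ is odd}, \end{cases} \] and $Z(C_{m,5}) = 1$.
   Context: For integers $m\ge 1$, $n \geq 2$, $C_{m,n}$ is the graph with vertex set $\{1,\dots,m\}\times\{1,\dots,n\}$ in which distinct vertices $(i,j)$ and $(i',j')$ are adjacent if and only if either $i=i'$ and $j-j' \equiv \pm 1 \pmod n$, or $j=j'$ and $|i-i'|=1$. For a finite simple graph $G$, the independence complex $I(G)$ is the simplicial complex on the ground set $V(G)$ whose faces are all independent sets of $G$ (including $\emptyset$), and $Z(G) = \sum_{\sigma \in I(G)} (-1)^{|\sigma|}$. $\simeq$ denotes homotopy equivalence (of geometric realizations) and $S^d$ is the $d$-dimensional sphere. *)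

theory Defs
  imports "HOL-Analysis.Analysis" "HOL-Number_Theory.Cong"
begin

text \<open>A simple graph is given by a vertex set \<open>V\<close> together with an adjacency relation \<open>E\<close>
  (symmetric and irreflexive on \<open>V\<close>). Abstract simplicial complexes are sets of faces and
  contain the empty face.\<close>

definition independence_complex :: "'a set \<Rightarrow> ('a \<Rightarrow> 'a \<Rightarrow> bool) \<Rightarrow> 'a set set" where
  "independence_complex V E = {\<sigma>. \<sigma> \<subseteq> V \<and> (\<forall>u\<in>\<sigma>. \<forall>v\<in>\<sigma>. \<not> E u v)}"

definition Z_value :: "'a set \<Rightarrow> ('a \<Rightarrow> 'a \<Rightarrow> bool) \<Rightarrow> int" where
  "Z_value V E = (\<Sum>\<sigma>\<in>independence_complex V E. (- 1) ^ card \<sigma>)"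

text \<open>The geometric realization in barycentric coordinates, with the topology of pointwise
  convergence. For finite complexes, the only ones used here, this is the usual topology of the
  realization (for infinite ones it may be strictly coarser). The empty face contributes no
  point, since its coordinates would have to sum to 1.\<close>

definition geometric_realization :: "'a set set \<Rightarrow> ('a \<Rightarrow> real) topology" where
  "geometric_realization K = subtopology (powertop_real UNIV)
     {x. (\<forall>v. 0 \<le> x v) \<and> {v. x v \<noteq> 0} \<in> K \<and> (\<Sum>v | x v \<noteq> 0. x v) = 1}"

definition C_verts :: "nat \<Rightarrow> nat \<Rightarrow> (nat \<times> nat) set" where
  "C_verts m n = {1..m} \<times> {1..n}"

definition C_adj :: "nat \<Rightarrow> nat \<Rightarrow> nat \<times> nat \<Rightarrow> nat \<times> nat \<Rightarrow> bool" where
  "C_adj m n = (\<lambda>(i, j) (i', j').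
     (i, j) \<in> C_verts m n \<and> (i', j') \<in> C_verts m n \<and> (i, j) \<noteq> (i', j') \<and>
     (i = i' \<and> ([int j - int j' = 1] (mod int n) \<or> [int j - int j' = - 1] (mod int n)) \<or>
      j = j' \<and> \<bar>int i - int i'\<bar> = 1))"

lemma finite_C_verts: "finite (C_verts m n)"
  by (simp add: C_verts_def)

lemma C_adj_irrefl: "\<not> C_adj m n u u"
  by (cases u) (simp add: C_adj_def)

lemma C_adj_sym: "C_adj m n u v \<Longrightarrow> C_adj m n v u"
proof -
  have flip: "[int b - int a = - c] (mod int n)" if "[int a - int b = c] (mod int n)" for a b c
    using that cong_minus_minus_iff[of "int a - int b" c "int n"] by simp
  assume "C_adj m n u v"
  then show "C_adj m n v u"
    using flip[of _ _ 1] flip[of _ _ "- 1"]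
    by (cases u; cases v) (auto simp: C_adj_def abs_minus_commute)
qed

end

theory Submission
  imports Defs
begin

text \<open>For \<open>m \<ge> 2\<close>, \<open>I(C_{m,5}) \<simeq> I(C_5 \<squnion> C_{m-2,5})\<close>: the second row of the cylinder can be deleted
  without changing the homotopy type. Doing this repeatedly deletes all even rows, so the
  graph becomes a disjoint union of \<open>k = \<lceil>m/2\<rceil>\<close> five-cycles. The independence complex of a
  5-cycle is a circle, that of a disjoint union is a join, and a join of \<open>k\<close> circles is a
  sphere of dimension \<open>2k - 1\<close>, which is \<open>m - 1\<close> for even and \<open>m\<close> for odd \<open>m\<close>.

  All deformations come from one move on simplicial complexes, \<open>cone_removal\<close>: if the link of a
  nonempty face \<open>\<sigma>\<close> is a cone, then the faces containing \<open>\<sigma>\<close> can be deleted. The move is a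
  deformation retraction, and it preserves the alternating face count because the deleted faces
  cancel in pairs. For independence complexes it turns into a rule about graphs,
  \<open>add_dominated_edges\<close>: a pair \<open>u, v\<close> may be joined whenever some third vertex \<open>w\<close> has all its
  neighbours among those of \<open>u\<close> and \<open>v\<close>. With \<open>u = v\<close> this deletes a vertex
  (\<open>delete_dominated_vertices\<close>). The heart of the argument is \<open>delete_second_cycle\<close>, which
  deletes the second row by such moves.

  Joins are avoided by also reducing each remaining 5-cycle to two disjoint edges, using the same
  moves. What is left is a perfect matching with \<open>2k\<close> edges. Its independence complex is
  the boundary of a cross polytope, for which both the homeomorphism with the sphere
  (\<open>cross_polytope_homeomorphic_sphere\<close>) and the alternating count \<open>(-1)^(2k) = 1\<close>
  (\<open>cross_polytope_sum\<close>) are explicit.\<close>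

section \<open>Homotopy type and alternating face count\<close>

text \<open>Every simplification below preserves both invariants of the theorem for the same combinatorial
  reason, so they are carried along in a single relation.\<close>

definition complex_equiv :: "'a set set \<Rightarrow> 'a set set \<Rightarrow> bool" (infix "\<simeq>" 50) where
  "K \<simeq> L \<longleftrightarrow> geometric_realization K homotopy_equivalent_space geometric_realization L \<and>
     (\<Sum>\<tau>\<in>K. (- 1 :: int) ^ card \<tau>) = (\<Sum>\<tau>\<in>L. (- 1) ^ card \<tau>)"

lemma complex_equiv_refl: "K \<simeq> K"
  by (simp add: complex_equiv_def homotopy_equivalent_space_refl)

lemma complex_equiv_sym: "K \<simeq> L \<Longrightarrow> L \<simeq> K"
  unfolding complex_equiv_def by (metis homotopy_equivalent_space_sym)

lemma complex_equiv_trans [trans]: "K \<simeq> L \<Longrightarrow> L \<simeq> M \<Longrightarrow> K \<simeq> M"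
  unfolding complex_equiv_def by (metis homotopy_eqv_trans)

text \<open>Summing over any finite set that contains the support, rather than over the support itself, keeps
  the index set of the sum fixed while the support changes along a deformation.\<close>

lemma in_topspace_realization:
  assumes "finite S" "{v. x v \<noteq> 0} \<subseteq> S"
  shows "x \<in> topspace (geometric_realization K) \<longleftrightarrow>
    (\<forall>v. 0 \<le> x v) \<and> {v. x v \<noteq> 0} \<in> K \<and> sum x S = 1"
proof -
  have "sum x {v. x v \<noteq> 0} = sum x S"
    by (rule sum.mono_neutral_left) (use assms in auto)
  then show ?thesis
    by (auto simp: geometric_realization_def)
qed

text \<open>A sum over an infinite set is 0 by convention, so coordinates with sum 1 have finite support.\<close>

lemma finite_support:
  assumes "x \<in> topspace (geometric_realization K)"
  shows "finite {v. x v \<noteq> 0}"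
  using assms sum.infinite[of "{v. x v \<noteq> 0}" x] by (force simp: geometric_realization_def)

lemma continuous_map_into_realization:
  assumes "\<And>v. continuous_map X euclideanreal (\<lambda>y. f y v)"
    and "\<And>y. y \<in> topspace X \<Longrightarrow> f y \<in> topspace (geometric_realization K)"
  shows "continuous_map X (geometric_realization K) f"
  using assms
  by (auto simp: geometric_realization_def continuous_map_in_subtopology
      continuous_map_componentwise_UNIV)

lemma continuous_map_barycentric_coordinate:
  "continuous_map (geometric_realization K) euclideanreal (\<lambda>x. x v)"
  unfolding geometric_realization_def
  by (intro continuous_map_from_subtopology continuous_map_product_projection) simp

lemma continuous_map_Min:
  fixes f :: "'b \<Rightarrow> 'a \<Rightarrow> real"
  assumes "finite S" "S \<noteq> {}" "\<And>v. v \<in> S \<Longrightarrow> continuous_map X euclideanreal (f v)"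
  shows "continuous_map X euclideanreal (\<lambda>y. Min ((\<lambda>v. f v y) ` S))"
  using assms
  by (induction S rule: finite_ne_induct) (auto intro: continuous_map_real_min)

section \<open>Removing the faces above a face with conical link\<close>

definition face_deletion :: "'a set set \<Rightarrow> 'a set \<Rightarrow> 'a set set" where
  "face_deletion K \<sigma> = {\<tau>\<in>K. \<not> \<sigma> \<subseteq> \<tau>}"

text \<open>The flow behind the deformation retraction: up to time \<open>s\<close>, the same mass
  \<open>s * Min (x ` \<sigma>)\<close> is taken from every vertex of \<open>\<sigma>\<close> and all of it is
  given to \<open>w\<close>. At time 1 the smallest coordinate on \<open>\<sigma>\<close> has been used up, so the
  support no longer contains \<open>\<sigma>\<close>.\<close>

definition push :: "'a set \<Rightarrow> 'a \<Rightarrow> real \<Rightarrow> ('a \<Rightarrow> real) \<Rightarrow> 'a \<Rightarrow> real" where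
  "push \<sigma> w s x v = x v - (if v \<in> \<sigma> then s * Min (x ` \<sigma>) else 0)
                       + (if v = w then real (card \<sigma>) * (s * Min (x ` \<sigma>)) else 0)"

text \<open>The assumption \<open>cone\<close> says that the link of \<open>\<sigma>\<close> is a cone with apex \<open>w\<close>. It is
  what allows mass to move from \<open>\<sigma>\<close> to \<open>w\<close> without leaving the complex.\<close>

context
  fixes K :: "'a set set" and \<sigma> :: "'a set" and w :: 'a
  assumes down: "\<And>\<tau> \<rho>. \<tau> \<in> K \<Longrightarrow> \<rho> \<subseteq> \<tau> \<Longrightarrow> \<rho> \<in> K"
    and fin: "finite \<sigma>" and ne: "\<sigma> \<noteq> {}" and w: "w \<notin> \<sigma>"
    and cone: "\<And>\<tau>. \<tau> \<in> K \<Longrightarrow> \<sigma> \<subseteq> \<tau> \<Longrightarrow> insert w \<tau> \<in> K"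
begin

lemma push_in_realization:
  assumes x: "x \<in> topspace (geometric_realization K)" and s: "0 \<le> s" "s \<le> 1"
  shows "push \<sigma> w s x \<in> topspace (geometric_realization K)"
    and "s = 1 \<Longrightarrow> push \<sigma> w s x \<in> topspace (geometric_realization (face_deletion K \<sigma>))"
    and "x \<in> topspace (geometric_realization (face_deletion K \<sigma>)) \<Longrightarrow> push \<sigma> w s x = x"
proof -
  define t where "t = Min (x ` \<sigma>)"
  define S where "S = insert w ({v. x v \<noteq> 0} \<union> \<sigma>)"
  have fS: "finite S" using finite_support[OF x] fin by (simp add: S_def)
  have xS: "{v. x v \<noteq> 0} \<subseteq> S" by (auto simp: S_def)
  have x0: "0 \<le> x v" and xK: "{v. x v \<noteq> 0} \<in> K" and x1: "sum x S = 1" for v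
    using x in_topspace_realization[OF fS xS] by auto
  have t_le: "t \<le> x v" if "v \<in> \<sigma>" for v
    using that fin by (simp add: t_def)
  have t_in: "t \<in> x ` \<sigma>" unfolding t_def using fin ne by simp
  have t0: "0 \<le> t" using t_in x0 by auto
  have st: "s * t \<le> t" "0 \<le> s * t" using s t0 by (auto simp: mult_left_le_one_le)
  have push: "push \<sigma> w s x v = x v - (if v \<in> \<sigma> then s * t else 0)
      + (if v = w then real (card \<sigma>) * (s * t) else 0)" for v
    by (simp add: push_def t_def)
  have pS: "{v. push \<sigma> w s x v \<noteq> 0} \<subseteq> S"
    by (auto simp: push S_def split: if_splits)
  have p0: "0 \<le> push \<sigma> w s x v" for v
    using t_le[of v] st x0[of v] by (auto simp: push)
  have "sum (push \<sigma> w s x) S = sum x S - (\<Sum>v\<in>S. if v \<in> \<sigma> then s * t else 0)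
      + (\<Sum>v\<in>S. if v = w then real (card \<sigma>) * (s * t) else 0)"
    by (simp add: push sum.distrib sum_subtractf)
  moreover have "(\<Sum>v\<in>S. if v \<in> \<sigma> then s * t else 0) = real (card \<sigma>) * (s * t)"
  proof -
    have "S \<inter> \<sigma> = \<sigma>" by (auto simp: S_def)
    then show ?thesis using fS by (simp flip: sum.inter_restrict)
  qed
  moreover have "(\<Sum>v\<in>S. if v = w then real (card \<sigma>) * (s * t) else 0) = real (card \<sigma>) * (s * t)"
    using fS by (simp add: S_def)
  ultimately have p1: "sum (push \<sigma> w s x) S = 1" using x1 by simp
  have trivial: "push \<sigma> w s x = x" if "t = 0" using that by (auto simp: push)
  \<comment> \<open>So points whose support does not contain \<open>\<sigma>\<close> stay fixed under the flow.\<close>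
  have t_pos: "t > 0 \<longleftrightarrow> \<sigma> \<subseteq> {v. x v \<noteq> 0}"
  proof
    assume "t > 0" then show "\<sigma> \<subseteq> {v. x v \<noteq> 0}" using t_le by force
  next
    assume "\<sigma> \<subseteq> {v. x v \<noteq> 0}" then show "t > 0" using t_in t0 by force
  qed
  have pK: "{v. push \<sigma> w s x v \<noteq> 0} \<in> K"
  proof (cases "t > 0")
    case True
    then have "insert w {v. x v \<noteq> 0} \<in> K" using cone[OF xK] t_pos by simp
    moreover have "{v. push \<sigma> w s x v \<noteq> 0} \<subseteq> insert w {v. x v \<noteq> 0}"
      using True t_pos by (auto simp: push split: if_splits)
    ultimately show ?thesis using down by blast
  next
    case False
    then show ?thesis using trivial t0 xK by simp
  qed
  show "push \<sigma> w s x \<in> topspace (geometric_realization K)"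
    using in_topspace_realization[OF fS pS] p0 p1 pK by blast
  show "push \<sigma> w s x \<in> topspace (geometric_realization (face_deletion K \<sigma>))" if "s = 1"
  proof -
    obtain v where v: "v \<in> \<sigma>" "x v = t" using t_in by auto
    then have "push \<sigma> w s x v = 0" using w that push[of v] by auto
    then have "{v. push \<sigma> w s x v \<noteq> 0} \<in> face_deletion K \<sigma>" using v pK by (auto simp: face_deletion_def)
    then show ?thesis
      using in_topspace_realization[OF fS pS] p0 p1 by blast
  qed
  show "push \<sigma> w s x = x" if "x \<in> topspace (geometric_realization (face_deletion K \<sigma>))"
  proof -
    have "{v. x v \<noteq> 0} \<in> face_deletion K \<sigma>" using that in_topspace_realization[OF fS xS] by blast
    then have "\<not> t > 0" unfolding t_pos by (simp add: face_deletion_def)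
    then show ?thesis using trivial t0 by simp
  qed
qed

lemma realization_deletion_subset: "x \<in> topspace (geometric_realization (face_deletion K \<sigma>)) \<Longrightarrow>
    x \<in> topspace (geometric_realization K)"
  by (auto simp: geometric_realization_def face_deletion_def)

lemma cone_removal_homotopy:
  "geometric_realization K homotopy_equivalent_space geometric_realization (face_deletion K \<sigma>)"
proof -
  let ?K = "geometric_realization K" and ?L = "geometric_realization (face_deletion K \<sigma>)"
  have c1: "continuous_map ?K ?L (push \<sigma> w 1)"
  proof (rule continuous_map_into_realization)
    show "continuous_map ?K euclideanreal (\<lambda>x. push \<sigma> w 1 x v)" for v
      unfolding push_def using fin ne
      by (cases "v \<in> \<sigma>"; cases "v = w")
        (auto intro!: continuous_intros continuous_map_barycentric_coordinate continuous_map_Min)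
  qed (simp add: push_in_realization)
  have c2: "continuous_map ?L ?K id"
    by (rule continuous_map_into_realization)
      (simp_all add: continuous_map_barycentric_coordinate realization_deletion_subset)
  let ?I = "prod_topology (top_of_set {0..1::real}) ?K"
  have c3: "continuous_map ?I ?K (\<lambda>(s, x). push \<sigma> w s x)"
  proof (rule continuous_map_into_realization)
    have s: "continuous_map ?I euclideanreal fst"
      by (metis continuous_map_fst continuous_map_into_fulltopology)
    have x: "continuous_map ?I euclideanreal (\<lambda>z. snd z v)" for v
      using continuous_map_compose[OF continuous_map_snd continuous_map_barycentric_coordinate]
      by (simp add: o_def)
    show "continuous_map ?I euclideanreal (\<lambda>y. (case y of (s, x) \<Rightarrow> push \<sigma> w s x) v)" for v
      unfolding push_def case_prod_unfold using fin ne
      by (cases "v \<in> \<sigma>"; cases "v = w")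
        (auto intro!: continuous_intros s x continuous_map_Min)
  qed (auto simp: push_in_realization)
  have "homotopic_with (\<lambda>x. True) ?K ?K id (id \<circ> push \<sigma> w 1)"
    unfolding homotopic_with_def using c3
    by (intro exI[of _ "\<lambda>(s, x). push \<sigma> w s x"]) (auto simp: push_def fun_eq_iff)
  moreover have "homotopic_with (\<lambda>x. True) ?L ?L (push \<sigma> w 1 \<circ> id) id"
  proof (rule homotopic_with_equal)
    show "continuous_map ?L ?L (push \<sigma> w 1 \<circ> id)"
      using c1 c2 by (rule continuous_map_compose[rotated])
  qed (use push_in_realization realization_deletion_subset in auto)
  ultimately show ?thesis
    unfolding homotopy_equivalent_space_def using c1 c2 homotopic_with_symD by blast
qed

text \<open>Adding or removing \<open>w\<close> is a sign-reversing involution on the deleted faces.\<close>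

lemma cone_removal_sum:
  assumes "finite (\<Union>K)"
  shows "(\<Sum>\<tau>\<in>K. (- 1 :: int) ^ card \<tau>) = (\<Sum>\<tau>\<in>face_deletion K \<sigma>. (- 1) ^ card \<tau>)"
proof -
  define A where "A = {\<tau>\<in>K. \<sigma> \<subseteq> \<tau> \<and> w \<notin> \<tau>}"
  have finK: "finite K" using assms finite_UnionD by blast
  have fins: "finite \<tau>" if "\<tau> \<in> K" for \<tau> using that assms by (meson Union_upper finite_subset)
  have K: "K = face_deletion K \<sigma> \<union> (A \<union> insert w ` A)"
  proof (intro set_eqI iffI)
    fix \<tau> assume t: "\<tau> \<in> K"
    show "\<tau> \<in> face_deletion K \<sigma> \<union> (A \<union> insert w ` A)"
    proof (cases "\<sigma> \<subseteq> \<tau> \<and> w \<in> \<tau>")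
      case True
      then have "\<tau> - {w} \<in> A" using down[OF t, of "\<tau> - {w}"] w by (auto simp: A_def)
      moreover have "\<tau> = insert w (\<tau> - {w})" using True by auto
      ultimately show ?thesis by blast
    qed (use t in \<open>auto simp: face_deletion_def A_def\<close>)
  qed (use cone in \<open>auto simp: face_deletion_def A_def\<close>)
  have inj: "inj_on (insert w) A" by (auto simp: inj_on_def A_def)
  have "(\<Sum>\<tau>\<in>insert w ` A. (- 1 :: int) ^ card \<tau>) = (\<Sum>\<tau>\<in>A. - ((- 1) ^ card \<tau>))"
    unfolding sum.reindex[OF inj] o_def
    by (rule sum.cong) (auto simp: A_def fins)
  moreover have "(\<Sum>\<tau>\<in>A \<union> insert w ` A. (- 1 :: int) ^ card \<tau>) =
      (\<Sum>\<tau>\<in>A. (- 1) ^ card \<tau>) + (\<Sum>\<tau>\<in>insert w ` A. (- 1) ^ card \<tau>)"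
    by (rule sum.union_disjoint) (use finK in \<open>auto simp: A_def\<close>)
  moreover have "(\<Sum>\<tau>\<in>K. (- 1 :: int) ^ card \<tau>) =
      (\<Sum>\<tau>\<in>face_deletion K \<sigma>. (- 1) ^ card \<tau>) + (\<Sum>\<tau>\<in>A \<union> insert w ` A. (- 1) ^ card \<tau>)"
    by (subst arg_cong[OF K, of "sum _"], rule sum.union_disjoint)
      (use finK in \<open>auto simp: A_def face_deletion_def\<close>)
  ultimately show ?thesis by (simp add: sum_negf)
qed

text \<open>Every homotopy equivalence between independence complexes below is composed of equivalences of
  this form and their inverses.\<close>

lemma cone_removal:
  assumes "finite (\<Union>K)"
  shows "K \<simeq> face_deletion K \<sigma>"
  using cone_removal_homotopy cone_removal_sum[OF assms]
  by (simp add: complex_equiv_def)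

end

section \<open>Dominated edges and vertices of a graph\<close>

text \<open>Adding the edge \<open>uv\<close> to a graph deletes the faces above \<open>{u, v}\<close> from its independence
  complex. If every neighbour of \<open>w\<close> is a neighbour of \<open>u\<close> or of \<open>v\<close>, then \<open>w\<close> can be
  added to any independent set that contains \<open>u\<close> and \<open>v\<close>, which makes the link of that face
  a cone. The case \<open>u = v\<close> is included: a loop at \<open>u\<close> has the effect of deleting the
  vertex \<open>u\<close>.\<close>

lemma add_dominated_edge:
  assumes V: "finite V" and E: "symp E" and uv: "u \<in> V" "v \<in> V"
    and w: "w \<in> V" "w \<noteq> u" "w \<noteq> v" "\<not> E w w"
    and dom: "\<And>x. x \<in> V \<Longrightarrow> E w x \<Longrightarrow> E u x \<or> E v x"
  shows "independence_complex V E \<simeq> independence_complex V (\<lambda>x y. E x y \<or> {x, y} = {u, v})"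
proof -
  let ?K = "independence_complex V E"
  have "?K \<simeq> face_deletion ?K {u, v}"
  proof (rule cone_removal[where w = w])
    fix \<tau> assume \<tau>: "\<tau> \<in> ?K" "{u, v} \<subseteq> \<tau>"
    have "\<not> E w x" "\<not> E x w" if "x \<in> \<tau>" for x
      using \<tau> that dom[of x] sympD[OF E] by (auto simp: independence_complex_def)
    then show "insert w \<tau> \<in> ?K"
      using \<tau> w by (auto simp: independence_complex_def)
  next
    show "finite (\<Union>?K)"
      by (rule finite_subset[OF _ V]) (auto simp: independence_complex_def)
  qed (use w in \<open>auto simp: independence_complex_def\<close>)
  also have "face_deletion ?K {u, v} = independence_complex V (\<lambda>x y. E x y \<or> {x, y} = {u, v})"
  proof (intro set_eqI iffI)
    fix \<tau> assume "\<tau> \<in> face_deletion ?K {u, v}"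
    then show "\<tau> \<in> independence_complex V (\<lambda>x y. E x y \<or> {x, y} = {u, v})"
      by (auto simp: face_deletion_def independence_complex_def doubleton_eq_iff)
  next
    fix \<tau> assume "\<tau> \<in> independence_complex V (\<lambda>x y. E x y \<or> {x, y} = {u, v})"
    then show "\<tau> \<in> face_deletion ?K {u, v}"
      by (auto simp: face_deletion_def independence_complex_def)
  qed
  finally show ?thesis .
qed

text \<open>A whole set \<open>F\<close> of edges can be added in any order, because the hypothesis asks the
  neighbourhood of the apex after all additions to be dominated by neighbourhoods before any of
  them: neighbourhoods only grow in between.\<close>

lemma add_dominated_edges:
  assumes V: "finite V" and E: "symp E" and F: "symp F"
    and apex: "\<And>u v. u \<in> V \<Longrightarrow> v \<in> V \<Longrightarrow> F u v \<Longrightarrow>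
      \<exists>w\<in>V - {u, v}. \<not> E w w \<and> \<not> F w w \<and> (\<forall>x\<in>V. E w x \<or> F w x \<longrightarrow> E u x \<or> E v x)"
  shows "independence_complex V E \<simeq> independence_complex V (\<lambda>x y. E x y \<or> F x y)"
proof -
  define G where "G = (\<lambda>S x y. E x y \<or> (x, y) \<in> S \<or> (y, x) \<in> S)"
  have "independence_complex V E \<simeq> independence_complex V (G S)"
    if "finite S" "S \<subseteq> {(x, y). x \<in> V \<and> y \<in> V \<and> F x y}" for S
    using that
  proof (induction S rule: finite_induct)
    case empty
    then show ?case by (simp add: G_def complex_equiv_refl)
  next
    case (insert e S)
    obtain u v where e: "e = (u, v)" by fastforce
    from insert.prems have uv: "u \<in> V" "v \<in> V" "F u v" and S: "S \<subseteq> {(x, y). x \<in> V \<and> y \<in> V \<and> F x y}"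
      by (auto simp: e)
    obtain w where w: "w \<in> V" "w \<noteq> u" "w \<noteq> v" "\<not> E w w" "\<not> F w w"
      "\<forall>x\<in>V. E w x \<or> F w x \<longrightarrow> E u x \<or> E v x"
      using apex[OF uv] by auto
    have "independence_complex V (G S) \<simeq> independence_complex V (\<lambda>x y. G S x y \<or> {x, y} = {u, v})"
    proof (rule add_dominated_edge[where w = w])
      show "symp (G S)" using sympD[OF E] by (auto simp: G_def symp_def)
      show "\<not> G S w w" using w S by (auto simp: G_def)
      show "G S u x \<or> G S v x" if "x \<in> V" "G S w x" for x
      proof -
        have "E w x \<or> F w x" using that S sympD[OF F] by (auto simp: G_def)
        then show ?thesis using w that by (auto simp: G_def)
      qed
    qed (use V uv w in auto)
    also have "(\<lambda>x y. G S x y \<or> {x, y} = {u, v}) = G (insert e S)"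
      by (auto simp: G_def e fun_eq_iff doubleton_eq_iff)
    finally show ?case using insert.IH[OF S] complex_equiv_trans by blast
  qed
  from this[of "{(x, y). x \<in> V \<and> y \<in> V \<and> F x y}"] V
  have "independence_complex V E \<simeq> independence_complex V (G {(x, y). x \<in> V \<and> y \<in> V \<and> F x y})"
    by (simp add: finite_subset[of _ "V \<times> V"] subset_iff)
  also have "independence_complex V (G {(x, y). x \<in> V \<and> y \<in> V \<and> F x y}) =
      independence_complex V (\<lambda>x y. E x y \<or> F x y)"
    unfolding independence_complex_def G_def by blast
  finally show ?thesis .
qed

text \<open>Deleting the vertices of \<open>D\<close> is the same as adding a loop at each of them.\<close>

lemma delete_dominated_vertices:
  assumes V: "finite V" and E: "symp E"
    and apex: "\<And>u. u \<in> D \<Longrightarrow> u \<in> V \<Longrightarrow>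
      \<exists>w\<in>V - D. \<not> E w w \<and> (\<forall>x\<in>V. E w x \<longrightarrow> E u x)"
  shows "independence_complex V E \<simeq> independence_complex (V - D) E"
proof -
  have "independence_complex V E \<simeq> independence_complex V (\<lambda>x y. E x y \<or> (x = y \<and> x \<in> D))"
  proof (rule add_dominated_edges[OF V E])
    show "symp (\<lambda>x y. x = y \<and> x \<in> D)" by (auto simp: symp_def)
    fix u v assume "u \<in> V" "u = v \<and> u \<in> D"
    with apex[of u] obtain w where w: "w \<in> V - D" "\<not> E w w" "\<forall>x\<in>V. E w x \<longrightarrow> E u x"
      by auto
    then show "\<exists>w\<in>V - {u, v}. \<not> E w w \<and> \<not> (w = w \<and> w \<in> D) \<and>
        (\<forall>x\<in>V. E w x \<or> w = x \<and> w \<in> D \<longrightarrow> E u x \<or> E v x)"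
      using \<open>u = v \<and> u \<in> D\<close> by (intro bexI[of _ w]) auto
  qed
  also have "independence_complex V (\<lambda>x y. E x y \<or> (x = y \<and> x \<in> D)) = independence_complex (V - D) E"
    unfolding independence_complex_def by blast
  finally show ?thesis .
qed

lemma independence_complex_cong:
  assumes "\<And>x y. x \<in> V \<Longrightarrow> y \<in> V \<Longrightarrow> E x y \<longleftrightarrow> E' x y"
  shows "independence_complex V E = independence_complex V E'"
  using assms unfolding independence_complex_def by blast

section \<open>The boundary of the cross polytope is a sphere\<close>

text \<open>The boundary complex of the \<open>n\<close>-dimensional cross polytope, with antipodal pairs
  \<open>p i\<close>, \<open>q i\<close>, provided that these are pairwise distinct. Equivalently, the independence complex of the perfect matching with
  edges \<open>{p i, q i}\<close>.\<close>

definition cross_polytope :: "(nat \<Rightarrow> 'a) \<Rightarrow> (nat \<Rightarrow> 'a) \<Rightarrow> nat \<Rightarrow> 'a set set" where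
  "cross_polytope p q n = {\<tau>. \<tau> \<subseteq> p ` {..<n} \<union> q ` {..<n} \<and> (\<forall>i<n. \<not> (p i \<in> \<tau> \<and> q i \<in> \<tau>))}"

context
  fixes p q :: "nat \<Rightarrow> 'a"
  assumes inj_p: "inj p" and inj_q: "inj q" and disj: "\<And>i j. p i \<noteq> q j"
begin

lemma cross_polytope_Suc:
  "cross_polytope p q (Suc n) = cross_polytope p q n \<union>
     (insert (p n) ` cross_polytope p q n \<union> insert (q n) ` cross_polytope p q n)"
  (is "?l = ?r")
proof (intro set_eqI iffI)
  fix \<tau> assume t: "\<tau> \<in> ?l"
  have sub: "\<tau> - {p n, q n} \<in> cross_polytope p q n"
    using t by (auto simp: cross_polytope_def lessThan_Suc)
  consider "p n \<in> \<tau>" "q n \<notin> \<tau>" | "p n \<notin> \<tau>" "q n \<in> \<tau>" | "p n \<notin> \<tau>" "q n \<notin> \<tau>"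
    using t by (auto simp: cross_polytope_def)
  then show "\<tau> \<in> ?r"
  proof cases
    case 1
    then have "\<tau> = insert (p n) (\<tau> - {p n, q n})" by auto
    then show ?thesis using sub by blast
  next
    case 2
    then have "\<tau> = insert (q n) (\<tau> - {p n, q n})" by auto
    then show ?thesis using sub by blast
  next
    case 3
    then show ?thesis using sub by simp
  qed
next
  fix \<tau> assume "\<tau> \<in> ?r"
  then show "\<tau> \<in> ?l"
    using disj disj[symmetric] injD[OF inj_p] injD[OF inj_q]
    unfolding cross_polytope_def by (auto simp: lessThan_Suc less_Suc_eq) blast+
qed

text \<open>A further antipodal pair replaces the complex by its suspension, which changes the sign: the
  faces through either new vertex each contribute the negative of the old sum.\<close>

lemma cross_polytope_sum: "(\<Sum>\<tau>\<in>cross_polytope p q n. (- 1 :: int) ^ card \<tau>) = (- 1) ^ n"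
proof (induction n)
  case 0
  have "cross_polytope p q 0 = {{}}" by (auto simp: cross_polytope_def)
  then show ?case by simp
next
  case (Suc n)
  let ?K = "cross_polytope p q n"
  have sub: "\<tau> \<subseteq> p ` {..<n} \<union> q ` {..<n}" if "\<tau> \<in> ?K" for \<tau>
    using that by (simp add: cross_polytope_def)
  have finK: "finite ?K"
    by (rule finite_subset[of _ "Pow (p ` {..<n} \<union> q ` {..<n})"]) (use sub in auto)
  have fin: "finite \<tau>" if "\<tau> \<in> ?K" for \<tau>
    using sub[OF that] by (rule finite_subset) simp
  have new: "p n \<notin> \<tau>" "q n \<notin> \<tau>" if "\<tau> \<in> ?K" for \<tau>
    using sub[OF that] disj disj[symmetric] injD[OF inj_p] injD[OF inj_q] by fastforce+
  have insert: "(\<Sum>\<tau>\<in>insert v ` ?K. (- 1 :: int) ^ card \<tau>) = - (\<Sum>\<tau>\<in>?K. (- 1) ^ card \<tau>)"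
    if v: "\<And>\<tau>. \<tau> \<in> ?K \<Longrightarrow> v \<notin> \<tau>" for v
  proof -
    have "inj_on (insert v) ?K" by (meson inj_onI insert_ident v)
    then have "(\<Sum>\<tau>\<in>insert v ` ?K. (- 1 :: int) ^ card \<tau>) = (\<Sum>\<tau>\<in>?K. (- 1) ^ card (insert v \<tau>))"
      by (simp add: sum.reindex)
    also have "\<dots> = (\<Sum>\<tau>\<in>?K. - ((- 1) ^ card \<tau>))"
      by (rule sum.cong) (auto simp: v fin)
    finally show ?thesis by (simp add: sum_negf)
  qed
  have "insert (p n) ` ?K \<inter> insert (q n) ` ?K = {}"
  proof (intro equals0I)
    fix \<tau> assume "\<tau> \<in> insert (p n) ` ?K \<inter> insert (q n) ` ?K"
    then have "p n \<in> \<tau>" and "p n \<notin> \<tau>" using new(1) disj[of n n] by auto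
    then show False by simp
  qed
  moreover have "?K \<inter> (insert (p n) ` ?K \<union> insert (q n) ` ?K) = {}"
    using new by blast
  ultimately have "(\<Sum>\<tau>\<in>cross_polytope p q (Suc n). (- 1 :: int) ^ card \<tau>) =
      (\<Sum>\<tau>\<in>?K. (- 1) ^ card \<tau>) + ((\<Sum>\<tau>\<in>insert (p n) ` ?K. (- 1) ^ card \<tau>) +
        (\<Sum>\<tau>\<in>insert (q n) ` ?K. (- 1) ^ card \<tau>))"
    unfolding cross_polytope_Suc using finK by (simp add: sum.union_disjoint)
  then show ?case using insert new Suc.IH by simp
qed

text \<open>A point of the realization uses at most one vertex of each antipodal pair, so it is determined by
  the differences \<open>x (p i) - x (q i)\<close>. These differences run through the unit sphere of the
  \<open>l\<^sub>1\<close>-norm, and rescaling carries it to the Euclidean unit sphere.\<close>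

definition to_sphere :: "nat \<Rightarrow> ('a \<Rightarrow> real) \<Rightarrow> nat \<Rightarrow> real" where
  "to_sphere n x i = (if i \<le> n then (x (p i) - x (q i)) / sqrt (\<Sum>j\<le>n. (x (p j) - x (q j))\<^sup>2) else 0)"

text \<open>Positive parts go to the vertices \<open>p i\<close>, negative parts to the \<open>q i\<close>. At each vertex at
  most one summand is nonzero; writing the coordinate as a sum makes continuity in
  \<open>y\<close> evident.\<close>

definition from_sphere :: "nat \<Rightarrow> (nat \<Rightarrow> real) \<Rightarrow> 'a \<Rightarrow> real" where
  "from_sphere n y v = (\<Sum>i\<le>n. (if v = p i then max (y i) 0 else 0) + (if v = q i then max (- y i) 0 else 0))
      / (\<Sum>i\<le>n. \<bar>y i\<bar>)"

lemma from_sphere_p: "i \<le> n \<Longrightarrow> from_sphere n y (p i) = max (y i) 0 / (\<Sum>i\<le>n. \<bar>y i\<bar>)"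
  unfolding from_sphere_def using disj inj_eq[OF inj_p] by (simp add: sum.distrib)

lemma from_sphere_q: "i \<le> n \<Longrightarrow> from_sphere n y (q i) = max (- y i) 0 / (\<Sum>i\<le>n. \<bar>y i\<bar>)"
  unfolding from_sphere_def using disj[symmetric] inj_eq[OF inj_q] by (simp add: sum.distrib)

lemma from_sphere_other: "v \<notin> p ` {..n} \<union> q ` {..n} \<Longrightarrow> from_sphere n y v = 0"
  unfolding from_sphere_def by (auto intro!: sum.neutral)

lemma sum_over_pairs:
  fixes x :: "'a \<Rightarrow> real"
  shows "sum x (p ` {..n} \<union> q ` {..n}) = (\<Sum>i\<le>n. x (p i) + x (q i))"
proof -
  have "sum x (p ` {..n} \<union> q ` {..n}) = sum x (p ` {..n}) + sum x (q ` {..n})"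
    by (rule sum.union_disjoint) (use disj in auto)
  then show ?thesis
    using inj_p inj_q by (simp add: sum.reindex inj_on_subset sum.distrib)
qed

lemma cross_polytope_homeomorphic_sphere:
  "geometric_realization (cross_polytope p q (Suc n)) homeomorphic_space nsphere n"
proof -
  let ?X = "geometric_realization (cross_polytope p q (Suc n))"
  let ?V = "p ` {..n} \<union> q ` {..n}"
  have X: "x \<in> topspace ?X \<longleftrightarrow> (\<forall>v. 0 \<le> x v) \<and> (\<forall>v. v \<notin> ?V \<longrightarrow> x v = 0) \<and>
      (\<forall>i\<le>n. x (p i) = 0 \<or> x (q i) = 0) \<and> (\<Sum>i\<le>n. x (p i) + x (q i)) = 1" for x
  proof -
    have faces: "{v. x v \<noteq> 0} \<in> cross_polytope p q (Suc n) \<longleftrightarrow>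
        {v. x v \<noteq> 0} \<subseteq> ?V \<and> (\<forall>i\<le>n. x (p i) = 0 \<or> x (q i) = 0)"
      by (simp add: cross_polytope_def lessThan_Suc_atMost less_Suc_eq_le disj_imp)
    have supp: "{v. x v \<noteq> 0} \<subseteq> ?V \<longleftrightarrow> (\<forall>v. v \<notin> ?V \<longrightarrow> x v = 0)" by blast
    show ?thesis
    proof (cases "{v. x v \<noteq> 0} \<subseteq> ?V")
      case True
      have "finite ?V" by simp
      from in_topspace_realization[OF this True, of "cross_polytope p q (Suc n)"] show ?thesis
        unfolding sum_over_pairs faces supp[symmetric] using True by simp
    next
      case False
      then have "x \<notin> topspace ?X" using faces by (simp add: geometric_realization_def)
      then show ?thesis unfolding supp[symmetric] using False by simp
    qed
  qed
  have l1: "(\<Sum>i\<le>n. \<bar>x (p i) - x (q i)\<bar>) = 1" if "x \<in> topspace ?X" for x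
  proof -
    have "(\<Sum>i\<le>n. \<bar>x (p i) - x (q i)\<bar>) = (\<Sum>i\<le>n. x (p i) + x (q i))"
      by (rule sum.cong) (use that X in \<open>force+\<close>)
    then show ?thesis using that X by simp
  qed
  have l2: "(\<Sum>i\<le>n. (x (p i) - x (q i))\<^sup>2) > 0" if "x \<in> topspace ?X" for x
  proof (rule ccontr)
    assume "\<not> ?thesis"
    then have "(\<Sum>i\<le>n. (x (p i) - x (q i))\<^sup>2) = 0"
      by (meson linorder_not_le order_antisym sum_nonneg zero_le_power2 less_imp_le)
    then have "\<forall>i\<le>n. x (p i) - x (q i) = 0" by (simp add: sum_nonneg_eq_0_iff)
    then show False using l1[OF that] by simp
  qed
  have Y: "y \<in> topspace (nsphere n) \<longleftrightarrow> (\<Sum>i\<le>n. (y i)\<^sup>2) = 1 \<and> (\<forall>i>n. y i = 0)" for y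
    by (simp add: nsphere)
  have s: "(\<Sum>i\<le>n. \<bar>y i\<bar>) > 0" if "y \<in> topspace (nsphere n)" for y
  proof (rule ccontr)
    assume "\<not> ?thesis"
    then have "(\<Sum>i\<le>n. \<bar>y i\<bar>) = 0" by (meson linorder_not_le order_antisym sum_nonneg abs_ge_zero)
    then have "\<forall>i\<le>n. y i = 0" by (simp add: sum_nonneg_eq_0_iff)
    then show False using that by (simp add: Y)
  qed
  have diff: "from_sphere n y (p i) - from_sphere n y (q i) = y i / (\<Sum>i\<le>n. \<bar>y i\<bar>)" if "i \<le> n" for i y
    using that by (auto simp: from_sphere_p from_sphere_q max_def simp flip: diff_divide_distrib)
  have add: "from_sphere n y (p i) + from_sphere n y (q i) = \<bar>y i\<bar> / (\<Sum>i\<le>n. \<bar>y i\<bar>)" if "i \<le> n" for i y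
    using that by (auto simp: from_sphere_p from_sphere_q max_def simp flip: add_divide_distrib)
  have from_in: "from_sphere n y \<in> topspace ?X" if y: "y \<in> topspace (nsphere n)" for y
    unfolding X
  proof (intro conjI allI impI)
    show "0 \<le> from_sphere n y v" for v
      unfolding from_sphere_def by (intro divide_nonneg_nonneg sum_nonneg) auto
    show "from_sphere n y (p i) = 0 \<or> from_sphere n y (q i) = 0" if "i \<le> n" for i
      using that by (auto simp: from_sphere_p from_sphere_q max_def)
    show "(\<Sum>i\<le>n. from_sphere n y (p i) + from_sphere n y (q i)) = 1"
      using s[OF y] by (simp add: add flip: sum_divide_distrib)
  qed (simp add: from_sphere_other)
  have to_in: "to_sphere n x \<in> topspace (nsphere n)" if x: "x \<in> topspace ?X" for x
    using l2[OF x] by (simp add: Y to_sphere_def power_divide flip: sum_divide_distrib)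
  have "continuous_map ?X (nsphere n) (to_sphere n)"
  proof -
    have "continuous_map ?X euclideanreal (\<lambda>x. to_sphere n x i)" for i
      unfolding to_sphere_def using l2
      by (cases "i \<le> n")
        (auto intro!: continuous_intros continuous_map_barycentric_coordinate simp: less_le)
    moreover have "to_sphere n \<in> topspace ?X \<rightarrow> topspace (nsphere n)" using to_in by auto
    ultimately show ?thesis
      by (simp add: nsphere continuous_map_in_subtopology continuous_map_componentwise_UNIV)
  qed
  moreover have "continuous_map (nsphere n) ?X (from_sphere n)"
  proof (rule continuous_map_into_realization)
    have c: "continuous_map (nsphere n) euclideanreal (\<lambda>y. if P then f y else 0)"
      if "continuous_map (nsphere n) euclideanreal f" for P f
      using that by (cases P) auto
    show "continuous_map (nsphere n) euclideanreal (\<lambda>y. from_sphere n y v)" for v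
      unfolding from_sphere_def using s
      by (intro continuous_intros c continuous_map_nsphere_projection) (auto simp: less_le)
  qed (rule from_in)
  moreover have "from_sphere n (to_sphere n x) = x" if x: "x \<in> topspace ?X" for x
  proof
    fix v
    define r where "r = sqrt (\<Sum>j\<le>n. (x (p j) - x (q j))\<^sup>2)"
    have r: "r > 0" using l2[OF x] by (simp add: r_def)
    have to: "to_sphere n x i = (x (p i) - x (q i)) / r" if "i \<le> n" for i
      using that by (simp add: to_sphere_def r_def)
    have sum: "(\<Sum>i\<le>n. \<bar>to_sphere n x i\<bar>) = 1 / r"
      using l1[OF x] r by (simp add: to abs_divide flip: sum_divide_distrib)
    consider i where "i \<le> n" "v = p i" | i where "i \<le> n" "v = q i" | "v \<notin> ?V" by auto
    then show "from_sphere n (to_sphere n x) v = x v"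
    proof cases
      case 1
      then have "x (p i) = 0 \<or> x (q i) = 0" "0 \<le> x (p i)" "0 \<le> x (q i)" using x X by auto
      moreover have "from_sphere n (to_sphere n x) v = max ((x (p i) - x (q i)) / r) 0 / (1 / r)"
        using 1 by (simp only: from_sphere_p sum to)
      ultimately show ?thesis using 1 r by (auto simp: max_def divide_simps)
    next
      case 2
      then have "x (p i) = 0 \<or> x (q i) = 0" "0 \<le> x (p i)" "0 \<le> x (q i)" using x X by auto
      moreover have "from_sphere n (to_sphere n x) v = max (- ((x (p i) - x (q i)) / r)) 0 / (1 / r)"
        using 2 by (simp only: from_sphere_q sum to)
      ultimately show ?thesis using 2 r by (auto simp: max_def divide_simps)
    next
      case 3
      then show ?thesis using x X from_sphere_other by simp
    qed
  qed
  moreover have "to_sphere n (from_sphere n y) = y" if y: "y \<in> topspace (nsphere n)" for y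
  proof
    fix i
    show "to_sphere n (from_sphere n y) i = y i"
      using s[OF y] y unfolding Y
      by (cases "i \<le> n")
        (simp_all add: to_sphere_def diff power_divide real_sqrt_divide flip: sum_divide_distrib)
  qed
  ultimately show ?thesis
    unfolding homeomorphic_space_def homeomorphic_maps_def by blast
qed

end

section \<open>Cutting off the first cycle of a cylinder\<close>

text \<open>The next column on the 5-cycle \<open>1, ..., 5\<close>. The previous column is written as the fourth iterate,
  so that positions on the cycle are normalised by the single law \<open>nx5\<close>.\<close>

definition nx :: "nat \<Rightarrow> nat" where
  "nx j = j mod 5 + 1"

lemma atLeastAtMost_1_5: "{1..5} = {1, 2, 3, 4, 5 :: nat}"
  by auto

lemma nx_in [simp]: "nx j \<in> {1..5}"
  by (simp add: nx_def)

lemma nx5 [simp]: "j \<in> {1..5} \<Longrightarrow> nx (nx (nx (nx (nx j)))) = j"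
  unfolding atLeastAtMost_1_5 by (elim insertE emptyE) (simp_all add: nx_def)

lemma nx_neq: "nx j \<noteq> j"
  unfolding nx_def by presburger

lemma nx_nx_neq: "nx (nx j) \<noteq> j"
  unfolding nx_def by presburger

lemma nx_cong_iff:
  assumes "j \<in> {1..5}" "j' \<in> {1..5}"
  shows "[int j - int j' = 1] (mod 5) \<or> [int j - int j' = - 1] (mod 5) \<longleftrightarrow> j' = nx j \<or> j = nx j'"
  using assms unfolding atLeastAtMost_1_5 
  by (elim insertE emptyE) (simp_all add: cong_def nx_def)

lemma C_adj_5_iff:
  assumes "(i, j) \<in> C_verts m 5" "(i', j') \<in> C_verts m 5"
  shows "C_adj m 5 (i, j) (i', j') \<longleftrightarrow>
    i = i' \<and> (j' = nx j \<or> j = nx j') \<or> j = j' \<and> (i' = i + 1 \<or> i = i' + 1)"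
proof -
  have "j \<in> {1..5}" "j' \<in> {1..5}" using assms by (simp_all add: C_verts_def)
  then have "[int j - int j' = 1] (mod int 5) \<or> [int j - int j' = - 1] (mod int 5) \<longleftrightarrow>
      j' = nx j \<or> j = nx j'"
    using nx_cong_iff by simp
  moreover have "\<bar>int i - int i'\<bar> = 1 \<longleftrightarrow> i' = i + 1 \<or> i = i' + 1" by linarith
  moreover have "j' = nx j \<or> j = nx j' \<Longrightarrow> j \<noteq> j'" using nx_neq by metis
  ultimately show ?thesis
    using assms by (simp add: C_adj_def) (metis n_not_Suc_n)
qed

text \<open>This is where the number 5 enters. Write \<open>a j\<close> for a 5-cycle that is attached to the rest of
  the graph only by the rungs \<open>a j - b j\<close>, where the \<open>b j\<close> contain a 5-cycle as well. One expects
  the link of \<open>b j\<close> to be contractible, since without the neighbours of \<open>b j\<close> the first cycle becomes a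
  path on four vertices; but that path is only detached from the rest of the graph once the other
  \<open>b i\<close> are neighbours of \<open>b j\<close>. Hence three rounds, with columns taken modulo 5:

  \<^item> The apex \<open>a (j + 1)\<close> has the neighbours \<open>a j\<close>, \<open>a (j + 2)\<close> and \<open>b (j + 1)\<close>, all of them
    adjacent to \<open>b j\<close> or \<open>b (j + 2)\<close>. So these two may be joined, and the \<open>b j\<close> become a complete
    graph.
  \<^item> The vertex \<open>a (j + 4)\<close> is now an apex for the pair \<open>b j\<close>, \<open>a (j + 2)\<close>, which may be joined.
    This deletes \<open>a (j + 2)\<close> from the path \<open>a (j + 1), ..., a (j + 4)\<close> in the link of \<open>b j\<close>, which
    isolates \<open>a (j + 1)\<close> there.
  \<^item> Now every neighbour of \<open>a (j + 1)\<close> is a neighbour of \<open>b j\<close>, so all \<open>b j\<close> may be deleted.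

  All auxiliary edges end at some \<open>b j\<close> and disappear together with these vertices.\<close>

lemma delete_second_cycle:
  fixes a b :: "nat \<Rightarrow> 'a"
  assumes V: "finite V" "\<And>j. j \<in> {1..5} \<Longrightarrow> a j \<in> V" "\<And>j. j \<in> {1..5} \<Longrightarrow> b j \<in> V"
    and inj: "inj a" "inj b" and disj: "\<And>i j. a i \<noteq> b j"
    and E: "symp E"
    and a: "\<And>j x. j \<in> {1..5} \<Longrightarrow> x \<in> V \<Longrightarrow>
      E (a j) x \<longleftrightarrow> x = b j \<or> x = a (nx j) \<or> x = a (nx (nx (nx (nx j))))"
    and b: "\<And>j. j \<in> {1..5} \<Longrightarrow> E (b j) (b (nx j))"
  shows "independence_complex V E \<simeq> independence_complex (V - b ` {1..5}) E"
proof -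
  note atLeastAtMost_iff [simp del] One_nat_def [simp del]
  note [simp] = V(2,3) inj_eq[OF inj(1)] inj_eq[OF inj(2)] disj disj[symmetric]
  have b': "E (b (nx j)) (b j)" if "j \<in> {1..5}" for j
    using b[OF that] sympD[OF E] by blast
  have ba: "E (b j) (a j)" if "j \<in> {1..5}" for j
    using a[OF that, of "b j"] that sympD[OF E] by simp
  have aa: "E (a j) (a (nx j))" "E (a (nx j)) (a j)" if "j \<in> {1..5}" for j
    using a[OF that, of "a (nx j)"] that sympD[OF E] by auto
  have irrefl: "\<not> E (a j) (a j)" if "j \<in> {1..5}" for j
    using a[OF that, of "a j"] that nx_neq[of j] nx_neq[of "nx (nx (nx (nx j)))"] by auto
  \<comment> \<open>\<open>F1\<close> and \<open>F2\<close> are the edges added in the first two rounds.\<close>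
  define F1 where "F1 x y \<longleftrightarrow> (\<exists>j\<in>{1..5}. x = b j \<and> y = b (nx (nx j)) \<or> y = b j \<and> x = b (nx (nx j)))" for x y
  define E1 where "E1 x y \<longleftrightarrow> E x y \<or> F1 x y" for x y
  define F2 where "F2 x y \<longleftrightarrow> (\<exists>j\<in>{1..5}. x = b j \<and> y = a (nx (nx j)) \<or> y = b j \<and> x = a (nx (nx j)))" for x y
  define E2 where "E2 x y \<longleftrightarrow> E1 x y \<or> F2 x y" for x y
  have F: "symp F1" "symp F2" by (auto simp: symp_def F1_def F2_def)
  have E1: "symp E1" using E F(1) by (auto simp: symp_def E1_def)
  have E2: "symp E2" using E1 F(2) by (auto simp: symp_def E2_def)
  have F1a: "\<not> F1 (a j) x" for j x by (auto simp: F1_def)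
  have bb: "E1 (b j) (b (nx (nx j)))" if "j \<in> {1..5}" for j
    using that by (auto simp: E1_def F1_def)
  have nx2: "i = nx (nx (nx j))" if "nx (nx i) = j" "i \<in> {1..5}" for i j
    using that by auto
  have F2a: "F2 (a j) x \<longleftrightarrow> x = b (nx (nx (nx j)))" if "j \<in> {1..5}" for j x
    using that nx2 nx5[OF that] unfolding F2_def by (auto intro!: bexI[of _ "nx (nx (nx j))"])
  have "independence_complex V E \<simeq> independence_complex V (\<lambda>x y. E x y \<or> F1 x y)"
  proof (rule add_dominated_edges[OF V(1) E F(1)])
    fix u v assume "F1 u v"
    then obtain j where j: "j \<in> {1..5}" and uv: "{u, v} = {b j, b (nx (nx j))}"
      by (auto simp: F1_def)
    have "E (b j) x \<or> E (b (nx (nx j))) x" if "x \<in> V" "E (a (nx j)) x" for x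
    proof -
      have "x = b (nx j) \<or> x = a (nx (nx j)) \<or> x = a j"
        using a[of "nx j" x] that j by simp
      then show ?thesis using b ba j by auto
    qed
    then have "\<forall>x\<in>V. E (a (nx j)) x \<or> F1 (a (nx j)) x \<longrightarrow> E u x \<or> E v x"
      using uv F1a by (auto simp: doubleton_eq_iff)
    moreover have "\<not> E (a (nx j)) (a (nx j))" using irrefl by simp
    moreover have "a (nx j) \<in> V - {u, v}" using uv by (auto simp: doubleton_eq_iff)
    ultimately show "\<exists>w\<in>V - {u, v}. \<not> E w w \<and> \<not> F1 w w \<and>
        (\<forall>x\<in>V. E w x \<or> F1 w x \<longrightarrow> E u x \<or> E v x)"
      using F1a by blast
  qed
  also have "(\<lambda>x y. E x y \<or> F1 x y) = E1" by (simp add: E1_def fun_eq_iff)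
  also have "independence_complex V E1 \<simeq> independence_complex V (\<lambda>x y. E1 x y \<or> F2 x y)"
  proof (rule add_dominated_edges[OF V(1) E1 F(2)])
    fix u v assume "F2 u v"
    then obtain j where j: "j \<in> {1..5}" and uv: "{u, v} = {b j, a (nx (nx j))}"
      by (auto simp: F2_def)
    let ?w = "a (nx (nx (nx (nx j))))"
    have "E1 (b j) x \<or> E1 (a (nx (nx j))) x" if "x \<in> V" "E1 ?w x \<or> F2 ?w x" for x
    proof -
      have "x = b (nx (nx (nx (nx j)))) \<or> x = a j \<or> x = a (nx (nx (nx j))) \<or> x = b (nx (nx j))"
        using that F1a F2a[of "nx (nx (nx (nx j)))"] a[of "nx (nx (nx (nx j)))" x] j
        by (auto simp: E1_def)
      then show ?thesis
        using b'[of "nx (nx (nx (nx j)))"] ba[OF j] bb[OF j] aa(1)[of "nx (nx j)"] j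
        by (auto simp: E1_def)
    qed
    then have "\<forall>x\<in>V. E1 ?w x \<or> F2 ?w x \<longrightarrow> E1 u x \<or> E1 v x"
      using uv by (auto simp: doubleton_eq_iff)
    moreover have "\<not> E1 ?w ?w"
      using irrefl[of "nx (nx (nx (nx j)))"] F1a by (simp add: E1_def)
    moreover have "\<not> F2 ?w ?w" by (simp add: F2a)
    moreover have "?w \<in> V - {u, v}"
      using uv j nx_nx_neq[of "nx (nx j)"] by (auto simp: doubleton_eq_iff)
    ultimately show "\<exists>w\<in>V - {u, v}. \<not> E1 w w \<and> \<not> F2 w w \<and>
        (\<forall>x\<in>V. E1 w x \<or> F2 w x \<longrightarrow> E1 u x \<or> E1 v x)"
      by blast
  qed
  also have "(\<lambda>x y. E1 x y \<or> F2 x y) = E2" by (simp add: E2_def fun_eq_iff)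
  also have "independence_complex V E2 \<simeq> independence_complex (V - b ` {1..5}) E2"
  proof (rule delete_dominated_vertices[OF V(1) E2])
    fix u assume "u \<in> b ` {1..5}"
    then obtain j where j: "j \<in> {1..5}" and u: "u = b j" by auto
    let ?w = "a (nx j)"
    have "E2 u x" if "x \<in> V" "E2 ?w x" for x
    proof -
      have "x = b (nx j) \<or> x = a (nx (nx j)) \<or> x = a j \<or> x = b (nx (nx (nx (nx j))))"
        using that F1a F2a[of "nx j"] a[of "nx j" x] j by (auto simp: E1_def E2_def)
      moreover have "F2 u (a (nx (nx j)))" using j by (auto simp: F2_def u)
      ultimately show ?thesis
        using b[OF j] b'[of "nx (nx (nx (nx j)))"] ba[OF j] j by (auto simp: E1_def E2_def u)
    qed
    moreover have "\<not> E2 ?w ?w"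
      using irrefl[of "nx j"] F1a F2a[of "nx j"] by (simp add: E1_def E2_def)
    moreover have "?w \<in> V - b ` {1..5}" by auto
    ultimately show "\<exists>w\<in>V - b ` {1..5}. \<not> E2 w w \<and> (\<forall>x\<in>V. E2 w x \<longrightarrow> E2 u x)"
      by blast
  qed
  also have "independence_complex (V - b ` {1..5}) E2 = independence_complex (V - b ` {1..5}) E"
    by (rule independence_complex_cong) (auto simp: E2_def E1_def F1_def F2_def)
  finally show ?thesis .
qed

section \<open>Reduction to a perfect matching\<close>

definition surviving_verts :: "nat \<Rightarrow> nat \<Rightarrow> (nat \<times> nat) set" where
  "surviving_verts m k = {(i, j) \<in> C_verts m 5. \<not> (even i \<and> i \<le> 2 * k)}"

text \<open>Row by row: once the rows \<open>2, 4, ..., 2k\<close> are gone, row \<open>2k + 1\<close> is attached only to row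
  \<open>2k + 2\<close>, which can then be deleted. If \<open>m\<close> is too small for that row to exist,
  there is nothing to delete.\<close>

lemma delete_even_rows:
  "independence_complex (C_verts m 5) (C_adj m 5) \<simeq>
   independence_complex (surviving_verts m k) (C_adj m 5)"
proof (induction k)
  case 0
  have "surviving_verts m 0 = C_verts m 5" by (auto simp: surviving_verts_def C_verts_def)
  then show ?case by (simp add: complex_equiv_refl)
next
  case (Suc k)
  let ?V = "surviving_verts m k"
  let ?a = "\<lambda>j. (2 * k + 1, j)" and ?b = "\<lambda>j. (2 * k + 2, j)"
  have V_Suc: "surviving_verts m (Suc k) = ?V - ?b ` {1..5}"
  proof -
    have "even i \<and> i \<le> 2 * Suc k \<longleftrightarrow> even i \<and> i \<le> 2 * k \<or> i = 2 * k + 2" for i :: nat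
      by (auto elim!: evenE)
    then show ?thesis
      unfolding surviving_verts_def C_verts_def by auto
  qed
  show ?case
  proof (cases "2 * k + 2 \<le> m")
    case True
    have aV: "?a j \<in> ?V" and bV: "?b j \<in> ?V" if "j \<in> {1..5}" for j
      using that True by (auto simp: surviving_verts_def C_verts_def)
    have verts: "x \<in> ?V \<Longrightarrow> x \<in> C_verts m 5" for x
      by (auto simp: surviving_verts_def)
    have "independence_complex ?V (C_adj m 5) \<simeq> independence_complex (?V - ?b ` {1..5}) (C_adj m 5)"
    proof (rule delete_second_cycle[where a = ?a])
      show "finite ?V"
        by (rule finite_subset[OF _ finite_C_verts]) (use verts in blast)
      show "symp (C_adj m 5)" by (simp add: symp_def C_adj_sym)
      show "C_adj m 5 (?b j) (?b (nx j))" if "j \<in> {1..5}" for j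
        using C_adj_5_iff verts bV that nx_in by blast
      show "C_adj m 5 (?a j) x \<longleftrightarrow> x = ?b j \<or> x = ?a (nx j) \<or> x = ?a (nx (nx (nx (nx j))))"
        if j: "j \<in> {1..5}" and x: "x \<in> ?V" for j x
      proof -
        obtain i' j' where x': "x = (i', j')" by fastforce
        have "j' \<in> {1..5}" and i': "i' \<noteq> 2 * k"
          using x by (auto simp: x' surviving_verts_def C_verts_def)
        then have "j = nx j' \<longleftrightarrow> j' = nx (nx (nx (nx j)))"
          using j nx5 by metis
        moreover have "C_adj m 5 (?a j) (i', j') \<longleftrightarrow> 2 * k + 1 = i' \<and> (j' = nx j \<or> j = nx j') \<or>
            j = j' \<and> (i' = 2 * k + 1 + 1 \<or> 2 * k + 1 = i' + 1)"
          using C_adj_5_iff verts[OF aV[OF j]] verts[OF x] unfolding x' by blast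
        ultimately show ?thesis using i' unfolding x' by auto
      qed
    qed (use aV bV in \<open>auto simp: inj_def\<close>)
    from Suc.IH this show ?thesis
      unfolding V_Suc by (rule complex_equiv_trans)
  next
    case False
    then have "?V - ?b ` {1..5} = ?V" by (auto simp: surviving_verts_def C_verts_def)
    then show ?thesis using Suc.IH V_Suc by simp
  qed
qed

definition odd_rows :: "nat \<Rightarrow> nat set \<Rightarrow> (nat \<times> nat) set" where
  "odd_rows m J = {i. odd i \<and> i \<le> m} \<times> J"

text \<open>Each row carries the path \<open>2 - 3 - 4 - 5 - 1\<close>, that is, the 5-cycle without the edge
  between the columns 1 and 2.\<close>

definition path_adj :: "nat \<times> nat \<Rightarrow> nat \<times> nat \<Rightarrow> bool" where
  "path_adj x y \<longleftrightarrow> fst x = fst y \<and>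
     (snd x, snd y) \<in> {(2, 3), (3, 2), (3, 4), (4, 3), (4, 5), (5, 4), (5, 1), (1, 5)}"

lemma symp_path_adj: "symp path_adj"
  by (auto simp: symp_def path_adj_def)

lemma finite_odd_rows: "finite J \<Longrightarrow> finite (odd_rows m J)"
  by (simp add: odd_rows_def)

text \<open>The neighbours 3 and 5 of column 4 are neighbours of 2 and of 1, so in every row column 4 is an
  apex for the missing edge.\<close>

lemma cycles_equiv_paths:
  "independence_complex (odd_rows m {1..5}) path_adj \<simeq>
   independence_complex (odd_rows m {1..5}) (C_adj m 5)"
proof -
  let ?V = "odd_rows m {1..5}"
  define F :: "nat \<times> nat \<Rightarrow> nat \<times> nat \<Rightarrow> bool"
    where "F x y \<longleftrightarrow> fst x = fst y \<and> (snd x, snd y) \<in> {(1, 2), (2, 1)}" for x y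
  have "independence_complex ?V path_adj \<simeq> independence_complex ?V (\<lambda>x y. path_adj x y \<or> F x y)"
  proof (rule add_dominated_edges)
    fix u v assume "u \<in> ?V" "F u v"
    moreover obtain i j i' j' where "u = (i, j)" "v = (i', j')" by fastforce
    ultimately show "\<exists>w\<in>?V - {u, v}. \<not> path_adj w w \<and> \<not> F w w \<and>
        (\<forall>x\<in>?V. path_adj w x \<or> F w x \<longrightarrow> path_adj u x \<or> path_adj v x)"
      by (intro bexI[of _ "(fst u, 4)"]) (auto simp: F_def path_adj_def odd_rows_def)
  next
    show "symp F" by (auto simp: symp_def F_def)
  qed (simp_all add: finite_odd_rows symp_path_adj)
  also have "independence_complex ?V (\<lambda>x y. path_adj x y \<or> F x y) = independence_complex ?V (C_adj m 5)"
  proof (rule independence_complex_cong)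
    fix x y assume xy: "x \<in> ?V" "y \<in> ?V"
    obtain i j i' j' where x: "x = (i, j)" and y: "y = (i', j')" by fastforce
    have j: "j \<in> {1..5}" "j' \<in> {1..5}" and i: "odd i" "odd i'" "i \<le> m" "i' \<le> m"
      using xy by (auto simp: x y odd_rows_def)
    have "(i, j) \<in> C_verts m 5" "(i', j') \<in> C_verts m 5"
      using i j by (auto simp: C_verts_def odd_pos Suc_le_eq)
    then have "C_adj m 5 x y \<longleftrightarrow> i = i' \<and> (j' = nx j \<or> j = nx j') \<or> j = j' \<and> (i' = i + 1 \<or> i = i' + 1)"
      by (simp only: C_adj_5_iff x y)
    also have "\<dots> \<longleftrightarrow> i = i' \<and> (j' = nx j \<or> j = nx j')" using i by auto
    also have "\<dots> \<longleftrightarrow> path_adj x y \<or> F x y"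
      using j unfolding atLeastAtMost_1_5
      by (elim insertE emptyE) (simp_all add: nx_def path_adj_def F_def x y)
    finally show "path_adj x y \<or> F x y \<longleftrightarrow> C_adj m 5 x y" by (rule sym)
  qed
  finally show ?thesis .
qed

text \<open>On the path \<open>2 - 3 - 4 - 5 - 1\<close> the end vertex 2 has the only neighbour 3, which is also a
  neighbour of 4. Deleting column 4 leaves the two disjoint edges \<open>2 - 3\<close> and \<open>5 - 1\<close>.\<close>

lemma paths_equiv_matching:
  "independence_complex (odd_rows m {1..5}) path_adj \<simeq>
   independence_complex (odd_rows m {1, 2, 3, 5}) path_adj"
proof -
  let ?V = "odd_rows m {1..5}" and ?D = "UNIV \<times> {4}"
  have "independence_complex ?V path_adj \<simeq> independence_complex (?V - ?D) path_adj"
  proof (rule delete_dominated_vertices)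
    fix u assume "u \<in> ?D" "u \<in> ?V"
    then show "\<exists>w\<in>?V - ?D. \<not> path_adj w w \<and> (\<forall>x\<in>?V. path_adj w x \<longrightarrow> path_adj u x)"
      by (intro bexI[of _ "(fst u, 2)"]) (auto simp: path_adj_def odd_rows_def)
  qed (simp_all add: finite_odd_rows symp_path_adj)
  also have "?V - ?D = odd_rows m {1, 2, 3, 5}"
    unfolding odd_rows_def atLeastAtMost_1_5 by auto
  finally show ?thesis .
qed

text \<open>The \<open>n\<close>-th antipodal pair. The odd row \<open>i\<close> holds the pairs \<open>i - 1\<close> (columns 2 and 3) and
  \<open>i\<close> (columns 5 and 1), which numbers the pairs from 0 without gaps.\<close>

definition pos_vertex :: "nat \<Rightarrow> nat \<times> nat" where
  "pos_vertex n = (if even n then (n + 1, 2) else (n, 5))"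

definition neg_vertex :: "nat \<Rightarrow> nat \<times> nat" where
  "neg_vertex n = (if even n then (n + 1, 3) else (n, 1))"

lemma odd_row_vertices:
  assumes "odd i"
  shows "(i, 1) = neg_vertex i" "(i, 5) = pos_vertex i"
    "(i, 2) = pos_vertex (i - 1)" "(i, 3) = neg_vertex (i - 1)"
  using assms by (simp_all add: pos_vertex_def neg_vertex_def odd_pos)

lemma matching_eq_cross_polytope:
  "independence_complex (odd_rows m {1, 2, 3, 5}) path_adj =
   cross_polytope pos_vertex neg_vertex (2 * ((m + 1) div 2))"
proof -
  let ?N = "2 * ((m + 1) div 2)" and ?V = "odd_rows m {1, 2, 3, 5}"
  have less_N: "n < ?N \<longleftrightarrow> (if even n then n + 1 \<le> m else n \<le> m)" for n
    by presburger
  have V: "?V = pos_vertex ` {..<?N} \<union> neg_vertex ` {..<?N}"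
  proof (intro set_eqI iffI)
    fix x assume "x \<in> ?V"
    then obtain i j where x: "x = (i, j)" and i: "odd i" "i \<le> m" and j: "j \<in> {1, 2, 3, 5}"
      by (auto simp: odd_rows_def)
    have "i < ?N" "i - 1 < ?N"
      using i unfolding less_N by (auto elim!: oddE)
    then show "x \<in> pos_vertex ` {..<?N} \<union> neg_vertex ` {..<?N}"
      using j odd_row_vertices[OF i(1)] unfolding x by blast
  next
    fix x assume "x \<in> pos_vertex ` {..<?N} \<union> neg_vertex ` {..<?N}"
    then obtain n where "n < ?N" "x = pos_vertex n \<or> x = neg_vertex n" by blast
    then show "x \<in> ?V"
      unfolding less_N by (auto simp: odd_rows_def pos_vertex_def neg_vertex_def split: if_splits)
  qed
  have adj: "\<exists>n<?N. {x, y} = {pos_vertex n, neg_vertex n}"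
    if "x \<in> ?V" "y \<in> ?V" "path_adj x y" for x y
  proof -
    define i j j' where "i = fst x" and "j = snd x" and "j' = snd y"
    with that have xy: "x = (i, j)" "y = (i, j')" and i: "odd i" "i \<le> m"
      and j: "j \<in> {1, 2, 3, 5}" "j' \<in> {1, 2, 3, 5}"
      by (auto simp: odd_rows_def path_adj_def prod_eq_iff)
    have n: "i < ?N" "i - 1 < ?N"
      using i unfolding less_N by (auto elim!: oddE)
    have "{x, y} = {(i, 2), (i, 3)} \<or> {x, y} = {(i, 5), (i, 1)}"
      using that(3) j unfolding xy path_adj_def by auto
    then show ?thesis
      using n unfolding odd_row_vertices[OF i(1)] by blast
  qed
  have adj': "path_adj (pos_vertex n) (neg_vertex n)" for n
    by (simp add: path_adj_def pos_vertex_def neg_vertex_def)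
  show ?thesis
  proof (intro set_eqI iffI)
    fix \<tau> assume "\<tau> \<in> independence_complex ?V path_adj"
    then have "\<tau> \<subseteq> ?V" and indep: "\<And>x y. x \<in> \<tau> \<Longrightarrow> y \<in> \<tau> \<Longrightarrow> \<not> path_adj x y"
      by (auto simp: independence_complex_def)
    moreover have "\<not> (pos_vertex n \<in> \<tau> \<and> neg_vertex n \<in> \<tau>)" for n
      using indep adj' by blast
    ultimately show "\<tau> \<in> cross_polytope pos_vertex neg_vertex ?N"
      unfolding cross_polytope_def V[symmetric] by simp
  next
    fix \<tau> assume "\<tau> \<in> cross_polytope pos_vertex neg_vertex ?N"
    then have \<tau>: "\<tau> \<subseteq> ?V" and no: "\<And>n. n < ?N \<Longrightarrow> \<not> {pos_vertex n, neg_vertex n} \<subseteq> \<tau>"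
      unfolding cross_polytope_def V[symmetric] by auto
    have "\<not> path_adj x y" if "x \<in> \<tau>" "y \<in> \<tau>" for x y
    proof
      assume "path_adj x y"
      with adj \<tau> that obtain n where "n < ?N" "{x, y} = {pos_vertex n, neg_vertex n}" by blast
      then show False using no that by (metis empty_subsetI insert_subset)
    qed
    then show "\<tau> \<in> independence_complex ?V path_adj"
      using \<tau> by (simp add: independence_complex_def)
  qed
qed

theorem proposition3p4:
  fixes m :: nat
  assumes "m \<ge> 1"
  shows "geometric_realization (independence_complex (C_verts m 5) (C_adj m 5))
           homotopy_equivalent_space nsphere (if even m then m - 1 else m)
         \<and> Z_value (C_verts m 5) (C_adj m 5) = 1"
proof -
  let ?n = "if even m then m - 1 else m"
  let ?C = "cross_polytope pos_vertex neg_vertex (Suc ?n)"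
  have N: "2 * ((m + 1) div 2) = Suc ?n" using assms by (auto elim!: evenE oddE)
  have inj: "inj pos_vertex" "inj neg_vertex" and disj: "\<And>i j. pos_vertex i \<noteq> neg_vertex j"
    by (auto simp: inj_def pos_vertex_def neg_vertex_def)
  have "surviving_verts m m = odd_rows m {1..5}"
    by (auto simp: surviving_verts_def odd_rows_def C_verts_def odd_pos Suc_le_eq)
  then have "independence_complex (C_verts m 5) (C_adj m 5) \<simeq>
      independence_complex (odd_rows m {1..5}) (C_adj m 5)"
    using delete_even_rows[of m m] by simp
  also have "\<dots> \<simeq> independence_complex (odd_rows m {1..5}) path_adj"
    using cycles_equiv_paths by (rule complex_equiv_sym)
  also have "\<dots> \<simeq> independence_complex (odd_rows m {1, 2, 3, 5}) path_adj"
    by (rule paths_equiv_matching)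
  also have "\<dots> = ?C" unfolding matching_eq_cross_polytope N ..
  finally have "geometric_realization (independence_complex (C_verts m 5) (C_adj m 5))
        homotopy_equivalent_space geometric_realization ?C"
    and "Z_value (C_verts m 5) (C_adj m 5) = (\<Sum>\<tau>\<in>?C. (- 1) ^ card \<tau>)"
    by (simp_all add: complex_equiv_def Z_value_def)
  moreover have "geometric_realization ?C homotopy_equivalent_space nsphere ?n"
    using cross_polytope_homeomorphic_sphere[OF inj disj] by (rule homeomorphic_imp_homotopy_equivalent_space)
  moreover have "(\<Sum>\<tau>\<in>?C. (- 1 :: int) ^ card \<tau>) = 1"
    unfolding cross_polytope_sum[OF inj disj] N[symmetric] by simp
  ultimately show ?thesis
    using homotopy_eqv_trans by auto
qed

end
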